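(* Let $d\ge 2$ be an integer. There is a constant $C>0$ depending only on $d$ such that for each integer $N\ge 2$ there exist $N$ full-rank lattices $\Lambda_1,\ldots,\Lambda_N\subseteq\mathbb{R}^d$ of volume $1$ satisfying $$\Lambda_i\cap\Lambda_j=\{0\}\quad\text{for all } i\neq j,$$ and a nonnegative function $f\in L^1(\mathbb{R}^d)$ that tiles with every $\Lambda_i$, $i=1,\ldots,N$, and satisfies $$\operatorname{diam}\operatorname{supp} f\le C\,N^{1/d}.$$
   Context: A full-rank lattice in $\mathbb{R}^d$ is a set $\Lambda=B\mathbb{Z}^d$ with $B\in\mathrm{GL}(d,\mathbb{R})$; its volume is $\mathrm{vol}(\Lambda)=|\det B|$ (independent of the choice of basis matrix $B$). A function $f\in L^1(\mathbb{R}^d)$ tiles with $\Lambda$ if there is a nonzero constant $c$ (the level) such that $\sum_{\lambda\in\Lambda}f(x-\lambda)=c$ for almost every $x\in\mathbb{R}^d$. The level may depend on the lattice. Here $\operatorname{supp} f$ is the (essential) support of $f$ and $\operatorname{diam}$ is the Euclidean diameter. *)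

theory Defs
  imports "HOL-Analysis.Analysis"
begin

definition int_vectors :: "(real ^ 'n) set" where
  "int_vectors = {z. \<forall>i. z $ i \<in> \<int>}"

definition lattice_of_basis :: "real ^ 'n ^ 'n \<Rightarrow> (real ^ 'n) set" where
  "lattice_of_basis B = (\<lambda>z. B *v z) ` int_vectors"

definition full_rank_lattice :: "(real ^ 'n) set \<Rightarrow> bool" where
  "full_rank_lattice L \<longleftrightarrow> (\<exists>B. invertible B \<and> L = lattice_of_basis B)"

text \<open>Meaningful for full-rank lattices only; \<open>lattice_volume_eq\<close> below shows independence
  of the basis matrix.\<close>

definition lattice_volume :: "(real ^ 'n) set \<Rightarrow> real" where
  "lattice_volume L =
     (THE v. \<exists>B. invertible B \<and> L = lattice_of_basis B \<and> v = \<bar>det B\<bar>)"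

text \<open>On the reals, \<^const>\<open>has_sum\<close> is unconditional, hence absolute, convergence.\<close>

definition tiles_with :: "(real ^ 'n \<Rightarrow> real) \<Rightarrow> (real ^ 'n) set \<Rightarrow> bool" where
  "tiles_with f L \<longleftrightarrow>
     (\<exists>c. c \<noteq> 0 \<and> (AE x in lebesgue. ((\<lambda>l. f (x - l)) has_sum c) L))"

text \<open>The complement of the largest open set on which the function vanishes almost everywhere.\<close>

definition ess_support :: "(real ^ 'n \<Rightarrow> real) \<Rightarrow> (real ^ 'n) set" where
  "ess_support f = - \<Union>{U. open U \<and> (AE x in lebesgue. x \<in> U \<longrightarrow> f x = 0)}"

lemma lattice_of_basis_eq_imp_int_factor:
  fixes A B :: "real ^ 'n ^ 'n"
  assumes "lattice_of_basis A \<subseteq> lattice_of_basis B"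
  shows "\<exists>M. A = B ** M \<and> det M \<in> \<int>"
proof -
  have "\<exists>z. z \<in> int_vectors \<and> column j A = B *v z" for j
  proof -
    have "axis j 1 \<in> (int_vectors :: (real ^ 'n) set)"
      by (auto simp: int_vectors_def axis_def)
    then have "A *v axis j 1 \<in> lattice_of_basis B"
      using assms by (auto simp: lattice_of_basis_def)
    then show ?thesis
      by (auto simp: lattice_of_basis_def matrix_vector_mul_component matrix_vector_mult_basis)
  qed
  then obtain z where z: "\<And>j. z j \<in> int_vectors" "\<And>j. column j A = B *v z j"
    by metis
  define M :: "real ^ 'n ^ 'n" where "M = (\<chi> i j. z j $ i)"
  have "A $ i $ j = (B ** M) $ i $ j" for i j
  proof -
    have "A $ i $ j = column j A $ i"
      by (simp add: column_def)
    also have "\<dots> = (B *v z j) $ i"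
      using z(2) by simp
    finally show ?thesis
      by (simp add: matrix_matrix_mult_def matrix_vector_mult_def M_def)
  qed
  then have "A = B ** M"
    by (simp add: vec_eq_iff)
  moreover have "M $ i $ j \<in> \<int>" for i j
    using z(1) by (simp add: M_def int_vectors_def)
  then have "det M \<in> \<int>"
    unfolding det_def by (intro Ints_sum Ints_mult Ints_prod) auto
  ultimately show ?thesis
    by blast
qed

lemma lattice_of_basis_eq_imp_abs_det_eq:
  fixes A B :: "real ^ 'n ^ 'n"
  assumes "invertible A" "invertible B" "lattice_of_basis A = lattice_of_basis B"
  shows "\<bar>det A\<bar> = \<bar>det B\<bar>"
proof -
  have le: "\<bar>det Y\<bar> \<le> \<bar>det X\<bar>"
    if "invertible X" "lattice_of_basis X = lattice_of_basis Y" for X Y :: "real ^ 'n ^ 'n"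
  proof -
    obtain M where M: "X = Y ** M" "det M \<in> \<int>"
      using lattice_of_basis_eq_imp_int_factor[of X Y] \<open>lattice_of_basis X = _\<close> by auto
    have det: "det X = det Y * det M"
      by (simp add: M(1) det_mul)
    with \<open>invertible X\<close> have "det M \<noteq> 0"
      by (auto simp: invertible_det_nz)
    with M(2) have "1 \<le> \<bar>det M\<bar>"
      by (rule Ints_nonzero_abs_ge1)
    then show ?thesis
      by (simp add: det abs_mult mult_le_cancel_left1)
  qed
  show ?thesis
    using le[of A B] le[of B A] assms by simp
qed

lemma lattice_volume_eq:
  fixes B :: "real ^ 'n ^ 'n"
  assumes "invertible B"
  shows "lattice_volume (lattice_of_basis B) = \<bar>det B\<bar>"
  unfolding lattice_volume_def
proof (rule the_equality)
  show "\<exists>A. invertible A \<and> lattice_of_basis B = lattice_of_basis A \<and> \<bar>det B\<bar> = \<bar>det A\<bar>"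
    using assms by blast
next
  fix v
  assume "\<exists>A. invertible A \<and> lattice_of_basis B = lattice_of_basis A \<and> v = \<bar>det A\<bar>"
  then show "v = \<bar>det B\<bar>"
    using lattice_of_basis_eq_imp_abs_det_eq assms by metis
qed

end

theory Submission
  imports Defs "HOL-Computational_Algebra.Polynomial"
begin

text \<open>
  Write \<open>d\<close> for the dimension, \<open>R = N\<^sup>1\<^sup>/\<^sup>d\<close> and \<open>r = 1 / R\<^sup>d\<^sup>-\<^sup>1\<close>, and fix two different
  coordinate directions \<open>a\<close> and \<open>b\<close>. The \<open>i\<close>-th lattice is generated by a very short vector
  \<open>v\<^sub>i = r (e\<^sub>a + s\<^sub>i e\<^sub>b)\<close> with \<open>0 \<le> s\<^sub>i \<le> 1\<close>, together with the long vectors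
  \<open>R e\<^sub>j + t\<^sub>i\<^sub>j v\<^sub>i\<close> for \<open>j \<noteq> a\<close>. Its volume is \<open>r R\<^sup>d\<^sup>-\<^sup>1 = 1\<close>, whatever the parameters are.

  The tile is the indicator of the half-open cube of side \<open>R\<close>, averaged over each of the \<open>N\<close>
  segments from \<open>0\<close> to \<open>v\<^sub>i\<close>; in other words, its convolution with the \<open>N\<close> uniform distributions
  on these segments. The usual construction convolves \<open>N\<close> fundamental domains, so that the diameter
  grows linearly in \<open>N\<close>. Here all lattices share the cube, and only the short segment is individual:
  the segments enlarge the support by at most \<open>N r = R\<close> in every coordinate, so that its diameter
  remains of order \<open>R = N\<^sup>1\<^sup>/\<^sup>d\<close>.

  The cube and a single segment suffice to tile with the lattice of that segment
  (\<open>segment_average_lattice_sum_cube\<close>). Averaging along \<open>v\<^sub>i\<close> and summing over the multiples of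
  \<open>v\<^sub>i\<close> integrates over the whole line in direction \<open>v\<^sub>i\<close>, where the shifts \<open>t\<^sub>i\<^sub>j v\<^sub>i\<close> become
  invisible. What remains of the long vectors are the plain vectors \<open>R e\<^sub>j\<close>, and under these the
  cube tiles the slab \<open>0 \<le> y\<^sub>a < R\<close>. A line in direction \<open>v\<^sub>i\<close> stays in this slab for the
  parameter length \<open>R / r\<close>, which is the level. Since summing over a lattice and averaging along
  segments all commute, the averages along the other segments do not destroy the tiling
  (\<open>lattice_sum_iterated_average\<close>).

  The numbers \<open>t\<^sub>i\<^sub>j\<close> are free, and they are used to make the lattices intersect trivially: they are taken to be
  distinct positive powers of a transcendental number. If a vector lies in the lattices \<open>i\<close> and
  \<open>i'\<close>, comparing its coordinates at \<open>a\<close> gives an integral linear relation between \<open>1\<close> and these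
  powers, so all coefficients of long vectors vanish, and the vector is a multiple of both \<open>v\<^sub>i\<close>
  and \<open>v\<^sub>i\<^sub>'\<close>. These are not parallel because \<open>s\<^sub>i \<noteq> s\<^sub>i\<^sub>'\<close>.
\<close>

section \<open>Averages along segments and sums over lattices\<close>

text \<open>The convolution of \<open>g\<close> with the uniform distribution on the segment from \<open>0\<close> to \<open>v\<close>. Extended
  nonnegative values make every interchange of sums and integrals below an instance of Tonelli's
  theorem.\<close>

definition segment_average :: "real ^ 'n \<Rightarrow> (real ^ 'n \<Rightarrow> ennreal) \<Rightarrow> real ^ 'n \<Rightarrow> ennreal" where
  "segment_average v g x = (\<integral>\<^sup>+u. g (x - u *\<^sub>R v) * indicator {0..<1} u \<partial>lborel)"

definition lattice_sum :: "(real ^ 'n) set \<Rightarrow> (real ^ 'n \<Rightarrow> ennreal) \<Rightarrow> real ^ 'n \<Rightarrow> ennreal" where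
  "lattice_sum L g x = (\<integral>\<^sup>+l. g (x - l) \<partial>count_space L)"

lemma segment_average_measurable [measurable]:
  assumes [measurable]: "g \<in> borel_measurable borel"
  shows "segment_average v g \<in> borel_measurable borel"
  unfolding segment_average_def by measurable

lemma segment_average_const: "segment_average v (\<lambda>x. c) = (\<lambda>x. c)"
  unfolding segment_average_def by (simp add: nn_integral_cmult_indicator)

lemma segment_average_le_1:
  assumes "\<And>x. g x \<le> 1"
  shows "segment_average v g x \<le> 1"
proof -
  have "segment_average v g x \<le> segment_average v (\<lambda>x. 1) x"
    unfolding segment_average_def using assms
    by (intro nn_integral_mono mult_right_mono) auto
  then show ?thesis
    by (simp add: segment_average_const)
qed

lemma segment_average_commute:
  assumes [measurable]: "g \<in> borel_measurable borel"
  shows "segment_average v (segment_average w g) = segment_average w (segment_average v g)"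
proof
  fix x
  have "segment_average v (segment_average w g) x =
      (\<integral>\<^sup>+u. \<integral>\<^sup>+s. g (x - u *\<^sub>R v - s *\<^sub>R w) * indicator {0..<1} s * indicator {0..<1} u \<partial>lborel \<partial>lborel)"
    unfolding segment_average_def by (simp add: nn_integral_multc)
  also have "\<dots> =
      (\<integral>\<^sup>+s. \<integral>\<^sup>+u. g (x - u *\<^sub>R v - s *\<^sub>R w) * indicator {0..<1} s * indicator {0..<1} u \<partial>lborel \<partial>lborel)"
    by (rule lborel_pair.Fubini') measurable
  also have "\<dots> =
      (\<integral>\<^sup>+s. \<integral>\<^sup>+u. g (x - s *\<^sub>R w - u *\<^sub>R v) * indicator {0..<1} u * indicator {0..<1} s \<partial>lborel \<partial>lborel)"
    by (simp add: ac_simps diff_diff_eq)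
  also have "\<dots> = segment_average w (segment_average v g) x"
    unfolding segment_average_def by (simp add: nn_integral_multc)
  finally show "segment_average v (segment_average w g) x = segment_average w (segment_average v g) x" .
qed

lemma lattice_sum_segment_average:
  assumes "countable L" and [measurable]: "g \<in> borel_measurable borel"
  shows "lattice_sum L (segment_average v g) = segment_average v (lattice_sum L g)"
proof
  fix x
  have "lattice_sum L (segment_average v g) x =
      (\<integral>\<^sup>+u. \<integral>\<^sup>+l. g (x - l - u *\<^sub>R v) * indicator {0..<1} u \<partial>count_space L \<partial>lborel)"
    unfolding lattice_sum_def segment_average_def
    by (subst nn_integral_count_space_nn_integral) (auto simp: assms(1))
  also have "\<dots> = (\<integral>\<^sup>+u. \<integral>\<^sup>+l. g (x - u *\<^sub>R v - l) * indicator {0..<1} u \<partial>count_space L \<partial>lborel)"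
    by (simp add: diff_diff_eq ac_simps)
  also have "\<dots> = segment_average v (lattice_sum L g) x"
    unfolding lattice_sum_def segment_average_def by (simp add: nn_integral_multc)
  finally show "lattice_sum L (segment_average v g) x = segment_average v (lattice_sum L g) x" .
qed

fun iterated_average :: "(nat \<Rightarrow> real ^ 'n) \<Rightarrow> (real ^ 'n \<Rightarrow> ennreal) \<Rightarrow> nat \<Rightarrow> real ^ 'n \<Rightarrow> ennreal" where
  "iterated_average v g 0 = g"
| "iterated_average v g (Suc k) = segment_average (v (Suc k)) (iterated_average v g k)"

lemma iterated_average_measurable [measurable]:
  "g \<in> borel_measurable borel \<Longrightarrow> iterated_average v g k \<in> borel_measurable borel"
  by (induction k) auto

lemma iterated_average_le_1:
  "(\<And>x. g x \<le> 1) \<Longrightarrow> iterated_average v g k x \<le> 1"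
  by (induction k arbitrary: x) (auto intro: segment_average_le_1)

text \<open>Once the average along \<open>w\<close> turns the lattice sum of \<open>g\<close> into a constant, it keeps doing so
  after averaging \<open>g\<close> along further segments, since all these operators commute and averaging fixes
  constants.\<close>

lemma segment_average_lattice_sum_iterated:
  assumes L: "countable L" and g: "g \<in> borel_measurable borel"
    and const: "segment_average w (lattice_sum L g) = (\<lambda>x. c)"
  shows "segment_average w (lattice_sum L (iterated_average v g k)) = (\<lambda>x. c)"
proof (induction k)
  case 0
  then show ?case using const by simp
next
  case (Suc k)
  let ?h = "iterated_average v g k" and ?v = "v (Suc k)"
  have [measurable]: "?h \<in> borel_measurable borel"
    using g by measurable
  have "segment_average w (lattice_sum L (segment_average ?v ?h))
      = lattice_sum L (segment_average w (segment_average ?v ?h))"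
    using L by (simp add: lattice_sum_segment_average)
  also have "\<dots> = lattice_sum L (segment_average ?v (segment_average w ?h))"
    by (simp add: segment_average_commute)
  also have "\<dots> = segment_average ?v (segment_average w (lattice_sum L ?h))"
    using L by (simp add: lattice_sum_segment_average)
  finally show ?case
    using Suc by (simp add: segment_average_const)
qed

text \<open>The \<open>i\<close>-th step of the iteration supplies the average along \<open>v i\<close> that makes the lattice sum
  constant, and the later steps preserve constants.\<close>

lemma lattice_sum_iterated_average:
  assumes L: "countable L" and g: "g \<in> borel_measurable borel"
    and const: "segment_average (v i) (lattice_sum L g) = (\<lambda>x. c)"
    and i: "1 \<le> i" "i \<le> k"
  shows "lattice_sum L (iterated_average v g k) = (\<lambda>x. c)"
  using i(2)
proof (induction k rule: dec_induct)
  case base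
  obtain j where "i = Suc j"
    using i(1) by (cases i) auto
  then show ?case
    using segment_average_lattice_sum_iterated[OF L g const, of v j] L g
    by (simp add: lattice_sum_segment_average)
next
  case (step k)
  then show ?case
    using L g by (simp add: lattice_sum_segment_average segment_average_const)
qed

text \<open>A nonzero value of an average at \<open>x\<close> forces a nonzero value at some \<open>x - u v\<close> with
  \<open>0 \<le> u < 1\<close>, so each segment extends the support by at most its own side lengths.\<close>

lemma iterated_average_support:
  assumes g: "\<And>x. g x \<noteq> 0 \<Longrightarrow> \<forall>j. 0 \<le> x $ j \<and> x $ j \<le> R"
    and v: "\<And>i j. i \<in> {1..k} \<Longrightarrow> 0 \<le> v i $ j \<and> v i $ j \<le> r"
    and nz: "iterated_average v g k x \<noteq> 0"
  shows "\<forall>j. 0 \<le> x $ j \<and> x $ j \<le> R + real k * r"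
  using v nz
proof (induction k arbitrary: x)
  case 0
  then show ?case using g by simp
next
  case (Suc k)
  have "\<exists>u. iterated_average v g k (x - u *\<^sub>R v (Suc k)) * indicator {0..<1} u \<noteq> 0"
  proof (rule ccontr)
    assume "\<not> ?thesis"
    then have "segment_average (v (Suc k)) (iterated_average v g k) x = 0"
      unfolding segment_average_def by (simp del: mult_eq_0_iff)
    then show False using Suc.prems(2) by simp
  qed
  then obtain u where u: "iterated_average v g k (x - u *\<^sub>R v (Suc k)) \<noteq> 0" "0 \<le> u" "u < 1"
    by (auto simp: indicator_def split: if_splits)
  have IH: "\<forall>j. 0 \<le> (x - u *\<^sub>R v (Suc k)) $ j \<and> (x - u *\<^sub>R v (Suc k)) $ j \<le> R + real k * r"
    using Suc.prems(1) u(1) by (intro Suc.IH) auto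
  show ?case
  proof
    fix j
    have vj: "0 \<le> v (Suc k) $ j" "v (Suc k) $ j \<le> r"
      using Suc.prems(1)[of "Suc k" j] by auto
    have "0 \<le> u * v (Suc k) $ j" "u * v (Suc k) $ j \<le> r"
      using u vj mult_mono[of u 1 "v (Suc k) $ j" r] by auto
    then show "0 \<le> x $ j \<and> x $ j \<le> R + real (Suc k) * r"
      using IH[rule_format, of j] by (simp add: algebra_simps)
  qed
qed

lemma has_sum_if_nn_integral_count_space:
  fixes h :: "'a \<Rightarrow> real"
  assumes h: "\<And>l. l \<in> L \<Longrightarrow> 0 \<le> h l" and c: "0 \<le> c"
    and eq: "(\<integral>\<^sup>+l. ennreal (h l) \<partial>count_space L) = ennreal c"
  shows "(h has_sum c) L"
proof -
  have "integrable (count_space L) h"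
    using h eq by (intro integrableI_nn_integral_finite[where x = c]) (auto simp: AE_count_space c)
  then have abs: "Infinite_Set_Sum.abs_summable_on h L"
    by (simp add: Infinite_Set_Sum.abs_summable_on_def)
  then have "infsum h L = c"
    using infsetsum_conv_nn_integral[of L h] h eq c by (simp add: infsetsum_infsum)
  moreover have "h summable_on L"
    using abs abs_summable_equivalent abs_summable_summable by blast
  ultimately show ?thesis
    using has_sum_infsum by blast
qed

section \<open>Skew lattices\<close>

text \<open>The matrix of \<open>x \<mapsto> x + (w \<bullet> x) e\<^sub>p\<close>.\<close>

definition shear :: "'n \<Rightarrow> real ^ 'n \<Rightarrow> real ^ 'n ^ 'n" where
  "shear p w = (\<chi> i j. (if i = j then 1 else 0) + (if i = p then w $ j else 0))"

lemma shear_mult: "shear p w *v x = x + (w \<bullet> x) *\<^sub>R axis p 1"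
  by (auto simp: shear_def matrix_vector_mult_def vec_eq_iff axis_def inner_vec_def
      distrib_right sum.distrib if_distribR if_distrib[of "\<lambda>y. y * _"] cong: if_cong)

lemma det_shear:
  fixes w :: "real ^ 'n"
  assumes "w $ p = 0"
  shows "det (shear p w) = 1"
proof -
  have "(\<Sum>j\<in>UNIV - {p}. (w $ j) *s row j (mat 1)) \<in> vec.span {row j (mat 1 :: real ^ 'n ^ 'n) |j. j \<noteq> p}"
    by (intro vec.span_sum vec.span_scale vec.span_base) auto
  moreover have "(\<Sum>j\<in>UNIV - {p}. (w $ j) *s row j (mat 1)) = w"
  proof -
    have "(\<Sum>j\<in>UNIV - {p}. (w $ j) *s row j (mat 1)) = (\<Sum>j\<in>UNIV. (w $ j) *s row j (mat 1 :: real ^ 'n ^ 'n))"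
      by (rule sum.mono_neutral_left) (auto simp: assms)
    also have "\<dots> = w"
      by (simp add: vec_eq_iff row_def mat_def if_distrib cong: if_cong)
    finally show ?thesis .
  qed
  ultimately have "det (\<chi> k. if k = p then row p (mat 1) + w else row k (mat 1)) = det (mat 1 :: real ^ 'n ^ 'n)"
    using det_row_span[of w "mat 1" p] by simp
  moreover have "(\<chi> k. if k = p then row p (mat 1) + w else row k (mat 1)) = shear p w"
    by (simp add: vec_eq_iff shear_def row_def mat_def)
  ultimately show ?thesis
    by simp
qed

text \<open>The basis matrix whose column \<open>a\<close> is \<open>r (e\<^sub>a + s e\<^sub>b)\<close> and whose column \<open>j \<noteq> a\<close> is \<open>R e\<^sub>j\<close> plus
  \<open>t\<^sub>j\<close> times column \<open>a\<close> (for \<open>t\<^sub>a = 0\<close>). Writing it as a product of a diagonal matrix and two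
  shears makes its determinant immediate.\<close>

definition skew_basis :: "'n \<Rightarrow> 'n \<Rightarrow> real \<Rightarrow> real \<Rightarrow> real \<Rightarrow> real ^ 'n \<Rightarrow> real ^ 'n ^ 'n" where
  "skew_basis a b r R s t =
     shear b (s *\<^sub>R axis a 1) ** (\<chi> i j. if i = j then if i = a then r else R else 0) ** shear a t"

definition short_vector :: "'n \<Rightarrow> 'n \<Rightarrow> real \<Rightarrow> real \<Rightarrow> real ^ 'n" where
  "short_vector a b r s = r *\<^sub>R (axis a 1 + s *\<^sub>R axis b 1)"

lemma skew_basis_mult:
  fixes a b :: "'n :: finite"
  assumes "a \<noteq> b"
  shows "skew_basis a b r R s t *v z =
    (z $ a + t \<bullet> z) *\<^sub>R short_vector a b r s + (\<chi> k. if k = a then 0 else R * z $ k)"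
proof -
  have diag: "(\<chi> i j. if i = j then if i = a then r else R else 0) *v x
      = (\<chi> i. (if i = a then r else R) * x $ i)" for x :: "real ^ 'n"
    by (simp add: matrix_vector_mult_def vec_eq_iff if_distrib[of "\<lambda>y. y * _"] cong: if_cong)
  have shear_b: "shear b (s *\<^sub>R axis a 1) *v x = x + (s * x $ a) *\<^sub>R axis b 1" for x :: "real ^ 'n"
    by (simp add: shear_mult inner_axis')
  show ?thesis
    using assms
    unfolding skew_basis_def matrix_vector_mul_assoc[symmetric] shear_b diag shear_mult[of a]
    by (auto simp: vec_eq_iff short_vector_def axis_def algebra_simps)
qed

lemma det_skew_basis:
  fixes a b :: "'n :: finite"
  assumes "a \<noteq> b" "t $ a = 0"
  shows "det (skew_basis a b r R s t) = r * R ^ (CARD('n) - 1)"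
proof -
  have "det (\<chi> i j. if i = j then if i = a then r else R else 0 :: real ^ 'n ^ 'n)
      = (\<Prod>i\<in>UNIV. if i = a then r else R)"
    by (subst det_diagonal) auto
  also have "\<dots> = r * (\<Prod>i\<in>UNIV - {a}. if i = a then r else R)"
    by (subst prod.remove[of _ a]) auto
  also have "(\<Prod>i\<in>UNIV - {a}. if i = a then r else R) = (\<Prod>i\<in>UNIV - {a}. R)"
    by (rule prod.cong) auto
  finally have "det (\<chi> i j. if i = j then if i = a then r else R else 0 :: real ^ 'n ^ 'n)
      = r * R ^ (CARD('n) - 1)"
    by simp
  then show ?thesis
    using assms by (simp add: skew_basis_def det_mul det_shear axis_def)
qed

lemma countable_int_vectors: "countable (int_vectors :: (real ^ 'n) set)"
proof -
  have "int_vectors \<subseteq> range (\<lambda>z :: 'n \<Rightarrow> int. \<chi> i. real_of_int (z i))"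
  proof
    fix x :: "real ^ 'n"
    assume "x \<in> int_vectors"
    then have "x = (\<chi> i. real_of_int \<lfloor>x $ i\<rfloor>)"
      by (simp add: int_vectors_def vec_eq_iff)
    then show "x \<in> range (\<lambda>z :: 'n \<Rightarrow> int. \<chi> i. real_of_int (z i))"
      by (metis range_eqI)
  qed
  then show ?thesis
    by (rule countable_subset) simp
qed

definition half_open_cube :: "real \<Rightarrow> (real ^ 'n) set" where
  "half_open_cube R = {x. \<forall>k. 0 \<le> x $ k \<and> x $ k < R}"

lemma half_open_cube_measurable [measurable]: "half_open_cube R \<in> sets borel"
  unfolding half_open_cube_def by measurable

lemma int_between_iff_floor:
  assumes "x \<in> \<int>"
  shows "0 \<le> y - x \<and> y - x < 1 \<longleftrightarrow> x = real_of_int \<lfloor>y\<rfloor>"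
  using assms by (auto elim!: Ints_cases) linarith+

text \<open>A point \<open>y\<close> of the slab \<open>0 \<le> y\<^sub>a < R\<close> lies in the cube translated by \<open>R z\<^sub>k\<close> in the directions
  \<open>k \<noteq> a\<close> for exactly one choice of these integers. As \<open>t\<^sub>a = 0\<close>, they determine \<open>t \<bullet> z\<close>, and then
  \<open>\<sigma> - t \<bullet> z\<close> lies in exactly one of the unit intervals that start at an integer \<open>z\<^sub>a\<close>.\<close>

lemma skew_cell_unique:
  fixes t :: "real ^ 'n"
  assumes R: "R > 0" and t: "t $ a = 0"
  shows "\<exists>z0 \<in> int_vectors. \<forall>z \<in> int_vectors.
    (y - (\<chi> k. if k = a then 0 else R * z $ k) \<in> half_open_cube R \<and> 0 \<le> \<sigma> - (z $ a + t \<bullet> z) \<and> \<sigma> - (z $ a + t \<bullet> z) < 1)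
    \<longleftrightarrow> (0 \<le> y $ a \<and> y $ a < R) \<and> z = z0"
proof -
  define z1 where "z1 = (\<chi> k. if k = a then 0 else real_of_int \<lfloor>y $ k / R\<rfloor>)"
  define z0 where "z0 = (\<chi> k. if k = a then real_of_int \<lfloor>\<sigma> - t \<bullet> z1\<rfloor> else real_of_int \<lfloor>y $ k / R\<rfloor>)"
  have dot: "t \<bullet> z = t \<bullet> z1" if "\<And>k. k \<noteq> a \<Longrightarrow> z $ k = real_of_int \<lfloor>y $ k / R\<rfloor>" for z
    unfolding inner_vec_def using that t by (intro sum.cong) (auto simp: z1_def)
  have cell: "0 \<le> y $ k - R * z $ k \<and> y $ k - R * z $ k < R \<longleftrightarrow> z $ k = real_of_int \<lfloor>y $ k / R\<rfloor>"
    if "z \<in> int_vectors" for z :: "real ^ 'n" and k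
  proof -
    have "0 \<le> y $ k - R * z $ k \<and> y $ k - R * z $ k < R \<longleftrightarrow> 0 \<le> y $ k / R - z $ k \<and> y $ k / R - z $ k < 1"
      using R by (auto simp: field_simps)
    then show ?thesis
      using that int_between_iff_floor[of "z $ k" "y $ k / R"] by (simp add: int_vectors_def)
  qed
  show ?thesis
  proof (intro bexI[of _ z0] ballI)
    show "z0 \<in> int_vectors"
      by (simp add: z0_def int_vectors_def)
    fix z :: "real ^ 'n"
    assume z: "z \<in> int_vectors"
    have "(y - (\<chi> k. if k = a then 0 else R * z $ k) \<in> half_open_cube R)
      \<longleftrightarrow> (0 \<le> y $ a \<and> y $ a < R) \<and> (\<forall>k. k \<noteq> a \<longrightarrow> z $ k = real_of_int \<lfloor>y $ k / R\<rfloor>)"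
      unfolding half_open_cube_def cell[OF z, symmetric] by auto
    moreover have "z = z0 \<longleftrightarrow> z $ a = real_of_int \<lfloor>\<sigma> - t \<bullet> z1\<rfloor> \<and> (\<forall>k. k \<noteq> a \<longrightarrow> z $ k = real_of_int \<lfloor>y $ k / R\<rfloor>)"
      by (auto simp: vec_eq_iff z0_def)
    moreover have "0 \<le> \<sigma> - (z $ a + t \<bullet> z) \<and> \<sigma> - (z $ a + t \<bullet> z) < 1 \<longleftrightarrow> z $ a = real_of_int \<lfloor>\<sigma> - t \<bullet> z\<rfloor>"
      using int_between_iff_floor[of "z $ a" "\<sigma> - t \<bullet> z"] z by (simp add: int_vectors_def algebra_simps)
    ultimately show "(y - (\<chi> k. if k = a then 0 else R * z $ k) \<in> half_open_cube R \<and> 0 \<le> \<sigma> - (z $ a + t \<bullet> z) \<and> \<sigma> - (z $ a + t \<bullet> z) < 1)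
       \<longleftrightarrow> (0 \<le> y $ a \<and> y $ a < R) \<and> z = z0"
      using dot[of z] by auto
  qed
qed

text \<open>Every lattice vector is \<open>c z\<close> times the short vector \<open>v\<close> plus a translation \<open>w z\<close> of the grid
  \<open>R \<int>\<close> in the directions other than \<open>a\<close>. The substitution \<open>\<sigma> = u + c z\<close> moves the dependence on
  \<open>c z\<close> from the cube into the unit interval. For a fixed \<open>\<sigma>\<close> at most one \<open>z\<close> contributes, by
  \<open>skew_cell_unique\<close>, and it does so exactly when \<open>x - \<sigma> v\<close> lies in the slab.\<close>

lemma segment_average_lattice_sum_cube:
  fixes t :: "real ^ 'n"
  assumes ab: "a \<noteq> b" and r: "r > 0" and R: "R > 0" and t: "t $ a = 0"
  shows "segment_average (short_vector a b r s)
      (lattice_sum (lattice_of_basis (skew_basis a b r R s t)) (indicator (half_open_cube R))) x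
    = ennreal (R / r)"
proof -
  let ?B = "skew_basis a b r R s t" and ?v = "short_vector a b r s"
  let ?Q = "half_open_cube R :: (real ^ 'n) set"
  define c where "c z = z $ a + t \<bullet> z" for z :: "real ^ 'n"
  define w where "w z = (\<chi> k. if k = a then 0 else R * z $ k)" for z :: "real ^ 'n"
  have B: "?B *v z = c z *\<^sub>R ?v + w z" for z
    using ab by (simp add: skew_basis_mult c_def w_def)
  have "det ?B \<noteq> 0"
    using assms by (simp add: det_skew_basis)
  then have "inj ((*v) ?B)"
    by (metis inj_matrix_vector_mult invertible_det_nz)
  then have bij: "bij_betw ((*v) ?B) int_vectors (lattice_of_basis ?B)"
    unfolding lattice_of_basis_def by (meson bij_betw_imageI inj_on_subset top_greatest)
  have cell: "(\<integral>\<^sup>+z. indicator ?Q (x - \<sigma> *\<^sub>R ?v - w z) * indicator {0..<1} (\<sigma> - c z) \<partial>count_space int_vectors)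
      = indicator {0..<R} (x $ a - r * \<sigma>)" for \<sigma>
  proof -
    have a: "(x - \<sigma> *\<^sub>R ?v) $ a = x $ a - r * \<sigma>"
      using ab by (simp add: short_vector_def axis_def)
    obtain z0 where z0: "z0 \<in> int_vectors"
      "\<And>z. z \<in> int_vectors \<Longrightarrow>
        (x - \<sigma> *\<^sub>R ?v - w z \<in> ?Q \<and> 0 \<le> \<sigma> - c z \<and> \<sigma> - c z < 1) \<longleftrightarrow> (0 \<le> x $ a - r * \<sigma> \<and> x $ a - r * \<sigma> < R) \<and> z = z0"
      using skew_cell_unique[OF R t, of "x - \<sigma> *\<^sub>R ?v" \<sigma>] unfolding a c_def w_def by blast
    have "(\<integral>\<^sup>+z. indicator ?Q (x - \<sigma> *\<^sub>R ?v - w z) * indicator {0..<1} (\<sigma> - c z) \<partial>count_space int_vectors)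
        = (\<integral>\<^sup>+z. indicator {0..<R} (x $ a - r * \<sigma>) * indicator {z0} z \<partial>count_space int_vectors)"
      using z0 by (intro nn_integral_cong) (auto simp: indicator_def)
    also have "\<dots> = indicator {0..<R} (x $ a - r * \<sigma>)"
      using z0(1) by (subst nn_integral_cmult_indicator) auto
    finally show ?thesis .
  qed
  have "segment_average ?v (lattice_sum (lattice_of_basis ?B) (indicator ?Q)) x
      = (\<integral>\<^sup>+u. (\<integral>\<^sup>+z. indicator ?Q (x - u *\<^sub>R ?v - ?B *v z) \<partial>count_space int_vectors) * indicator {0..<1} u \<partial>lborel)"
    unfolding segment_average_def lattice_sum_def
    by (subst nn_integral_bij_count_space[OF bij, symmetric]) simp
  also have "\<dots> = (\<integral>\<^sup>+u. \<integral>\<^sup>+z. indicator ?Q (x - u *\<^sub>R ?v - ?B *v z) * indicator {0..<1} u \<partial>count_space int_vectors \<partial>lborel)"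
    by (simp add: nn_integral_multc)
  also have "\<dots> = (\<integral>\<^sup>+z. \<integral>\<^sup>+u. indicator ?Q (x - u *\<^sub>R ?v - ?B *v z) * indicator {0..<1} u \<partial>lborel \<partial>count_space int_vectors)"
    by (rule nn_integral_count_space_nn_integral[OF countable_int_vectors]) measurable
  also have "\<dots> = (\<integral>\<^sup>+z. \<integral>\<^sup>+\<sigma>. indicator ?Q (x - \<sigma> *\<^sub>R ?v - w z) * indicator {0..<1} (\<sigma> - c z) \<partial>lborel \<partial>count_space int_vectors)"
  proof (rule nn_integral_cong)
    fix z :: "real ^ 'n"
    have "(\<integral>\<^sup>+\<sigma>. indicator ?Q (x - \<sigma> *\<^sub>R ?v - w z) * indicator {0..<1} (\<sigma> - c z) \<partial>lborel)
      = (\<integral>\<^sup>+u. indicator ?Q (x - (c z + u) *\<^sub>R ?v - w z) * indicator {0..<1} u \<partial>lborel)"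
      by (subst nn_integral_real_affine[where c = 1 and t = "c z"]) auto
    then show "(\<integral>\<^sup>+u. indicator ?Q (x - u *\<^sub>R ?v - ?B *v z) * indicator {0..<1} u \<partial>lborel)
      = (\<integral>\<^sup>+\<sigma>. indicator ?Q (x - \<sigma> *\<^sub>R ?v - w z) * indicator {0..<1} (\<sigma> - c z) \<partial>lborel)"
      by (simp add: B algebra_simps)
  qed
  also have "\<dots> = (\<integral>\<^sup>+\<sigma>. \<integral>\<^sup>+z. indicator ?Q (x - \<sigma> *\<^sub>R ?v - w z) * indicator {0..<1} (\<sigma> - c z) \<partial>count_space int_vectors \<partial>lborel)"
    by (rule nn_integral_count_space_nn_integral[OF countable_int_vectors, symmetric]) measurable
  also have "\<dots> = (\<integral>\<^sup>+\<sigma>. indicator {(x $ a - R) / r <.. x $ a / r} \<sigma> \<partial>lborel)"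
    unfolding cell using r by (intro nn_integral_cong) (auto simp: indicator_def field_simps)
  also have "\<dots> = ennreal (R / r)"
    using r R by (simp add: diff_divide_distrib divide_right_mono)
  finally show ?thesis .
qed

section \<open>Generic skews and trivial intersections\<close>

text \<open>Polynomials with integer coefficients are given by lists of integers, so there are only
  countably many algebraic numbers.\<close>

lemma ex_transcendental_real: "\<exists>\<theta>::real. \<not> algebraic \<theta>"
proof -
  let ?p = "\<lambda>l :: int list. Poly (map real_of_int l)"
  have "countable (\<Union>l\<in>{l. ?p l \<noteq> 0}. {x. poly (?p l) x = 0})"
    by (rule countable_UN) (auto intro: countable_finite poly_roots_finite)
  moreover have "{x::real. algebraic x} \<subseteq> (\<Union>l\<in>{l. ?p l \<noteq> 0}. {x. poly (?p l) x = 0})"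
  proof
    fix x :: real
    assume "x \<in> {x. algebraic x}"
    then obtain p where p: "\<And>i. coeff p i \<in> \<int>" "p \<noteq> 0" "poly p x = 0"
      by (auto simp: algebraic_def)
    have "?p (map floor (coeffs p)) = Poly (coeffs p)"
      using p(1) by (auto intro!: arg_cong[where f = Poly] map_idI simp: o_def coeffs_def)
    then have "?p (map floor (coeffs p)) = p"
      by simp
    then show "x \<in> (\<Union>l\<in>{l. ?p l \<noteq> 0}. {x. poly (?p l) x = 0})"
      using p by (metis (mono_tags, lifting) UN_I mem_Collect_eq)
  qed
  ultimately have "countable {x::real. algebraic x}"
    by (rule countable_subset[rotated])
  then have "{x::real. algebraic x} \<noteq> UNIV"
    using uncountable_UNIV_real by metis
  then show ?thesis
    by blast
qed

text \<open>The pairs \<open>(i, j)\<close> receive different exponents, and \<open>Suc\<close> keeps the exponent \<open>0\<close> free for the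
  coefficient of the short vector.\<close>

definition generic_skew :: "real \<Rightarrow> 'n :: finite \<Rightarrow> nat \<Rightarrow> real ^ 'n" where
  "generic_skew \<theta> a i = (\<chi> j. if j = a then 0 else \<theta> ^ Suc (to_nat (i, j)))"

text \<open>The equation says that \<open>\<theta>\<close> is a root of a polynomial with integer coefficients. This polynomial
  is therefore zero, and its coefficients are \<open>z\<^sub>a - z'\<^sub>a\<close> and, up to sign, the other coordinates of
  \<open>z\<close> and \<open>z'\<close>.\<close>

lemma generic_skew_independent:
  fixes a :: "'n :: finite" and z z' :: "real ^ 'n"
  assumes \<theta>: "\<not> algebraic \<theta>" and ii: "i \<noteq> i'" and z: "z \<in> int_vectors" "z' \<in> int_vectors"
    and eq: "z $ a + generic_skew \<theta> a i \<bullet> z = z' $ a + generic_skew \<theta> a i' \<bullet> z'"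
  shows "z $ a = z' $ a" and "j \<noteq> a \<Longrightarrow> z $ j = 0"
proof -
  define q :: "nat \<Rightarrow> real ^ 'n \<Rightarrow> real poly" where
    "q i z = (\<Sum>j\<in>UNIV - {a}. monom (z $ j) (Suc (to_nat (i, j))))" for i z
  define p where "p = monom (z $ a - z' $ a) 0 + q i z - q i' z'"
  have poly_q: "poly (q i z) \<theta> = generic_skew \<theta> a i \<bullet> z" for i z
  proof -
    have "generic_skew \<theta> a i \<bullet> z = (\<Sum>j\<in>UNIV - {a}. generic_skew \<theta> a i $ j * z $ j)"
      unfolding inner_vec_def by (subst sum.remove[of _ a]) (auto simp: generic_skew_def)
    then show ?thesis
      by (simp add: q_def poly_sum poly_monom generic_skew_def ac_simps)
  qed
  have coeff_q: "coeff (q k z) (Suc (to_nat (i, j))) = (if k = i then z $ j else 0)" if "j \<noteq> a" for k i j z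
    using that by (auto simp: q_def coeff_sum if_distrib cong: if_cong)
  have q_Ints: "coeff (q k z) m \<in> \<int>" if "z \<in> int_vectors" for k z m
    using that unfolding q_def coeff_sum by (intro Ints_sum) (auto simp: int_vectors_def)
  have q_0: "coeff (q k z) 0 = 0" for k z
    by (simp add: q_def coeff_sum)
  have "coeff p m \<in> \<int>" for m
    using z q_Ints by (auto simp: p_def int_vectors_def)
  moreover have "poly p \<theta> = 0"
    using eq by (simp add: p_def poly_q poly_monom)
  ultimately have p0: "p = 0"
    using \<theta> by (auto simp: algebraic_def)
  have "coeff p 0 = z $ a - z' $ a"
    by (simp add: p_def q_0)
  then show "z $ a = z' $ a"
    by (simp add: p0)
  show "z $ j = 0" if "j \<noteq> a"
  proof -
    have "coeff p (Suc (to_nat (i, j))) = z $ j"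
      using ii by (simp add: p_def coeff_q[OF that])
    then show ?thesis
      by (simp add: p0)
  qed
qed

text \<open>Coordinate \<open>a\<close> of a common vector shows that the coefficients of all long vectors vanish. After
  that, coordinate \<open>b\<close> compares the same multiple of two different slopes.\<close>

lemma generic_skew_lattices_inter:
  fixes a b :: "'n :: finite"
  assumes \<theta>: "\<not> algebraic \<theta>" and ab: "a \<noteq> b" and r: "r > 0" and ii: "i \<noteq> i'" and s: "s \<noteq> s'"
  shows "lattice_of_basis (skew_basis a b r R s (generic_skew \<theta> a i)) \<inter>
    lattice_of_basis (skew_basis a b r R s' (generic_skew \<theta> a i')) = {0}"
proof -
  have 0: "0 \<in> lattice_of_basis B" for B :: "real ^ 'n ^ 'n"
    unfolding lattice_of_basis_def by (rule image_eqI[of _ _ 0]) (auto simp: int_vectors_def)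
  have "x = 0"
    if x: "x = skew_basis a b r R s (generic_skew \<theta> a i) *v z"
      "x = skew_basis a b r R s' (generic_skew \<theta> a i') *v z'"
      and z: "z \<in> int_vectors" "z' \<in> int_vectors" for x z z'
  proof -
    let ?c = "z $ a + generic_skew \<theta> a i \<bullet> z" and ?c' = "z' $ a + generic_skew \<theta> a i' \<bullet> z'"
    have "x $ a = r * ?c"
      using ab by (subst x(1)) (simp add: skew_basis_mult short_vector_def axis_def)
    moreover have "x $ a = r * ?c'"
      using ab by (subst x(2)) (simp add: skew_basis_mult short_vector_def axis_def)
    ultimately have c: "?c = ?c'"
      using r by simp
    have zj: "z $ j = 0" "z' $ j = 0" if "j \<noteq> a" for j
      using generic_skew_independent(2)[OF \<theta> ii z c that]
        generic_skew_independent(2)[OF \<theta> ii[symmetric] z(2,1) c[symmetric] that] by auto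
    have "x $ b = ?c * (r * s)"
      using ab zj[of b] by (subst x(1)) (simp add: skew_basis_mult short_vector_def axis_def)
    moreover have "x $ b = ?c' * (r * s')"
      using ab zj[of b] by (subst x(2)) (simp add: skew_basis_mult short_vector_def axis_def)
    ultimately have "?c * (r * (s - s')) = 0"
      using c by (simp add: algebra_simps)
    then have "?c = 0"
      using r s by simp
    then show "x = 0"
      using zj by (simp add: x(1) skew_basis_mult[OF ab] vec_eq_iff)
  qed
  then show ?thesis
    using 0 unfolding lattice_of_basis_def by blast
qed

section \<open>Support and diameter\<close>

lemma ess_support_subset_closed:
  assumes "closed K" "\<And>x. x \<notin> K \<Longrightarrow> f x = 0"
  shows "ess_support f \<subseteq> K"
proof -
  have "- K \<in> {U. open U \<and> (AE x in lebesgue. x \<in> U \<longrightarrow> f x = 0)}"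
    using assms by auto
  then show ?thesis
    unfolding ess_support_def by blast
qed

lemma diameter_cbox_cart_le:
  assumes "0 \<le> M"
  shows "diameter (cbox 0 (\<chi> k. M) :: (real ^ 'n) set) \<le> real CARD('n) * M"
proof (rule diameter_le)
  show "cbox 0 (\<chi> k. M) \<noteq> {} \<or> 0 \<le> real CARD('n) * M"
    using assms by simp
  fix x y :: "real ^ 'n"
  assume xy: "x \<in> cbox 0 (\<chi> k. M)" "y \<in> cbox 0 (\<chi> k. M)"
  have "norm (x - y) \<le> (\<Sum>k\<in>UNIV. \<bar>(x - y) $ k\<bar>)"
    by (rule norm_le_l1_cart)
  also have "\<dots> \<le> (\<Sum>k\<in>(UNIV :: 'n set). M)"
    using xy by (intro sum_mono) (auto simp: mem_box_cart abs_le_iff intro: order_trans[OF diff_mono])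
  finally show "norm (x - y) \<le> real CARD('n) * M"
    by simp
qed

section \<open>A small common tile for many lattices\<close>

text \<open>In the notation of the introduction the slopes are \<open>s\<^sub>i = 1 / i\<close>. The support lies in the cube
  \<open>[0, 2 R]\<^sup>d\<close>, whose diameter is at most \<open>2 d R\<close>.\<close>

theorem theorem1p1:
  assumes "CARD('n::finite) \<ge> 2"
  shows "\<exists>C::real. C > 0 \<and>
    (\<forall>N::nat. N \<ge> 2 \<longrightarrow>
      (\<exists>\<Lambda> :: nat \<Rightarrow> (real ^ 'n) set.
        (\<forall>i\<in>{1..N}. full_rank_lattice (\<Lambda> i) \<and> lattice_volume (\<Lambda> i) = 1) \<and>
        (\<forall>i\<in>{1..N}. \<forall>j\<in>{1..N}. i \<noteq> j \<longrightarrow> \<Lambda> i \<inter> \<Lambda> j = {0}) \<and>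
        (\<exists>f :: real ^ 'n \<Rightarrow> real.
          integrable lebesgue f \<and> (\<forall>x. f x \<ge> 0) \<and>
          (\<forall>i\<in>{1..N}. tiles_with f (\<Lambda> i)) \<and>
          bounded (ess_support f) \<and>
          diameter (ess_support f) \<le> C * real N powr (1 / real CARD('n)))))"
proof (intro exI[of _ "2 * real CARD('n)"] conjI allI impI)
  show "0 < 2 * real CARD('n)"
    by simp
  fix N :: nat
  assume N: "2 \<le> N"
  have "\<not> (\<exists>a. (UNIV :: 'n set) = {a})"
    using assms by (metis card.empty card.insert empty_iff finite.emptyI not_less_eq_eq numeral_2_eq_2 le_refl)
  then obtain a b :: 'n where ab: "a \<noteq> b"
    by (metis UNIV_eq_I singletonI)
  obtain \<theta> :: real where \<theta>: "\<not> algebraic \<theta>"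
    using ex_transcendental_real by blast
  define R where "R = real N powr (1 / real CARD('n))"
  define r where "r = 1 / R ^ (CARD('n) - 1)"
  have R: "R > 0"
    using N by (simp add: R_def)
  then have r: "r > 0"
    by (simp add: r_def)
  have "R ^ CARD('n) = real N"
    using N by (simp add: R_def powr_power)
  moreover have "R ^ CARD('n) = R * R ^ (CARD('n) - 1)"
    by (metis power_eq_if zero_less_card_finite less_irrefl)
  (* This balances the two contributions to the support: N segments of length about r together are
     as long as a side of the cube. *)
  ultimately have Nr: "real N * r = R"
    using R by (simp add: r_def field_simps)
  define s where "s i = 1 / real i" for i :: nat
  define B where "B i = skew_basis a b r R (s i) (generic_skew \<theta> a i)" for i
  define v where "v i = short_vector a b r (s i)" for i
  define \<Lambda> where "\<Lambda> i = lattice_of_basis (B i)" for i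
  have t: "generic_skew \<theta> a i $ a = 0" for i
    by (simp add: generic_skew_def)
  have det: "det (B i) = 1" for i
    using R by (simp add: B_def det_skew_basis[OF ab t] r_def)
  have inv: "invertible (B i)" for i
    by (simp add: invertible_det_nz det)
  have countable: "countable (\<Lambda> i)" for i
    unfolding \<Lambda>_def lattice_of_basis_def using countable_int_vectors by blast
  define Q where "Q = (half_open_cube R :: (real ^ 'n) set)"
  define F where "F = iterated_average v (indicator Q) N"
  define f where "f x = enn2real (F x)" for x
  have Q [measurable]: "indicator Q \<in> borel_measurable borel"
    unfolding Q_def by measurable
  have F [measurable]: "F \<in> borel_measurable borel"
    unfolding F_def by measurable
  have F_le: "F x \<le> 1" for x
    unfolding F_def by (rule iterated_average_le_1) (simp add: indicator_def)
  have f: "ennreal (f x) = F x" "0 \<le> f x" "f x \<le> 1" for x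
    using F_le[of x] by (auto simp: f_def intro!: ennreal_enn2real enn2real_leI intro: le_less_trans)
  define K where "K = cbox 0 ((\<chi> k. 2 * R) :: real ^ 'n)"
  have supp: "f x = 0" if "x \<notin> K" for x
  proof (rule ccontr)
    assume "f x \<noteq> 0"
    then have nz: "iterated_average v (indicator Q) N x \<noteq> 0"
      by (auto simp: f_def F_def)
    have "\<forall>j. 0 \<le> x $ j \<and> x $ j \<le> R + real N * r"
    proof (rule iterated_average_support[OF _ _ nz])
      show "0 \<le> v i $ j \<and> v i $ j \<le> r" if "i \<in> {1..N}" for i j
        using that r ab by (auto simp: v_def short_vector_def s_def axis_def field_simps)
    qed (auto simp: Q_def half_open_cube_def indicator_def less_imp_le split: if_splits)
    then have "x \<in> K"
      by (simp add: K_def Nr mem_box_cart)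
    then show False
      using that by simp
  qed
  have "integrable lborel f"
  proof (rule Bochner_Integration.integrable_bound)
    show "integrable lborel (indicat_real K)"
      using emeasure_bounded_finite[of K] by (simp add: K_def integrable_indicator_iff)
    show "f \<in> borel_measurable lborel"
      unfolding f_def by measurable
    show "AE x in lborel. norm (f x) \<le> norm (indicat_real K x)"
      using f supp by (auto simp: indicator_def)
  qed
  then have integrable: "integrable lebesgue f"
    by (simp add: integrable_completion)
  have tiles: "tiles_with f (\<Lambda> i)" if i: "i \<in> {1..N}" for i
  proof -
    have "segment_average (v i) (lattice_sum (\<Lambda> i) (indicator Q)) = (\<lambda>x. ennreal (R / r))"
      unfolding v_def \<Lambda>_def B_def Q_def
      by (rule ext) (rule segment_average_lattice_sum_cube[OF ab r R t])
    then have "lattice_sum (\<Lambda> i) F = (\<lambda>x. ennreal (R / r))"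
      unfolding F_def using i countable by (intro lattice_sum_iterated_average[where i = i]) auto
    then have "(\<integral>\<^sup>+l. ennreal (f (x - l)) \<partial>count_space (\<Lambda> i)) = ennreal (R / r)" for x
      unfolding f lattice_sum_def by metis
    then have "((\<lambda>l. f (x - l)) has_sum R / r) (\<Lambda> i)" for x
      using R r f by (intro has_sum_if_nn_integral_count_space) auto
    then show ?thesis
      unfolding tiles_with_def using R r by (intro exI[of _ "R / r"]) auto
  qed
  have sub: "ess_support f \<subseteq> K"
    using supp by (intro ess_support_subset_closed) (auto simp: K_def)
  have bdd: "bounded K"
    by (simp add: K_def)
  have "diameter (ess_support f) \<le> diameter K"
    using sub bdd by (rule diameter_subset)
  also have "\<dots> \<le> real CARD('n) * (2 * R)"
    unfolding K_def using R by (intro diameter_cbox_cart_le) simp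
  finally have diam: "diameter (ess_support f) \<le> 2 * real CARD('n) * real N powr (1 / real CARD('n))"
    by (simp add: R_def)
  show "\<exists>\<Lambda> :: nat \<Rightarrow> (real ^ 'n) set.
        (\<forall>i\<in>{1..N}. full_rank_lattice (\<Lambda> i) \<and> lattice_volume (\<Lambda> i) = 1) \<and>
        (\<forall>i\<in>{1..N}. \<forall>j\<in>{1..N}. i \<noteq> j \<longrightarrow> \<Lambda> i \<inter> \<Lambda> j = {0}) \<and>
        (\<exists>f :: real ^ 'n \<Rightarrow> real.
          integrable lebesgue f \<and> (\<forall>x. f x \<ge> 0) \<and>
          (\<forall>i\<in>{1..N}. tiles_with f (\<Lambda> i)) \<and>
          bounded (ess_support f) \<and>
          diameter (ess_support f) \<le> 2 * real CARD('n) * real N powr (1 / real CARD('n)))"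
  proof (intro exI[of _ \<Lambda>] exI[of _ f] conjI ballI allI impI)
    show "full_rank_lattice (\<Lambda> i)" for i
      using inv by (auto simp: full_rank_lattice_def \<Lambda>_def)
    show "lattice_volume (\<Lambda> i) = 1" for i
      by (simp add: \<Lambda>_def lattice_volume_eq[OF inv] det)
    show "\<Lambda> i \<inter> \<Lambda> j = {0}" if "i \<in> {1..N}" "j \<in> {1..N}" "i \<noteq> j" for i j
      unfolding \<Lambda>_def B_def using that
      by (intro generic_skew_lattices_inter \<theta> ab r) (auto simp: s_def)
    show "bounded (ess_support f)"
      using sub bdd bounded_subset by blast
  qed (use integrable f tiles diam in auto)
qed

end
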